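(* Let $X$ and $Y$ be real Hilbert spaces, let $A\colon X\to Y$ be linear, continuous and nonzero, let $b\in Y$, and let $\beta\geq\|A^*A\|$. Set $f\colon X\to\mathbb{R}\colon x\mapsto\frac12\|Ax-b\|^2$ and $g:=\iota_X\equiv 0$, and suppose that $S:=\operatorname{Argmin}f\neq\varnothing$. Let $T:=\operatorname{P}_{\frac1\beta g}\circ(\operatorname{Id}-\frac1\beta\nabla f)$ be the corresponding proximal gradient operator. Then $Tx=x-\frac1\beta A^*(Ax-b)$ for every $x\in X$. Moreover, if $(t_n)_{n\in\mathbb{N}}$ is a FISTA parameter sequence, $x_0\in X$, and $(x_n)_{n\in\mathbb{N}}$, $(y_n)_{n\in\mathbb{N}}$ are the FISTA sequences generated by $T$, $(t_n)_{n\in\mathbb{N}}$ and the starting point $x_0$, then $(x_n)_{n\in\mathbb{N}}$ and $(y_n)_{n\in\mathbb{N}}$ converge strongly (in norm): $$x_n\to P_Sx_0\quad\text{and}\quad y_n\to P_Sx_0.$$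
   Context: $\mathbb{N}=\{0,1,2,\ldots\}$. $\iota_X$ is the indicator function of $X$, i.e. the zero function on $X$. $A^*$ is the adjoint of $A$. $\operatorname{P}_{h}$ denotes the proximal operator of a convex, lower semicontinuous, proper function $h$: $\operatorname{P}_h(x)$ is the unique minimizer over $z\in X$ of $h(z)+\frac12\|z-x\|^2$. $\operatorname{Argmin}f$ is the set of minimizers of $f$, and $P_C$ is the metric projection onto a nonempty closed convex set $C$. FISTA parameter sequence: a real sequence $(t_n)_{n\in\mathbb{N}}$ with $t_0=1$ such that for every $n\in\mathbb{N}$, $t_n\geq\frac{n+2}{2}$ and $t_n^2\geq t_{n+1}^2-t_{n+1}$. FISTA sequences (here: Nesterov's accelerated gradient descent): given $x_0\in X$, set $y_0:=x_0$ and, for every $n\in\mathbb{N}$, $x_{n+1}:=Ty_n$ and $y_{n+1}:=x_{n+1}+\frac{t_n-1}{t_{n+1}}(x_{n+1}-x_n)$. *)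

theory Defs
  imports "HOL-Analysis.Analysis"
begin

text \<open>A real Hilbert space is a type of class \<open>{real_inner, complete_space}\<close>. The operators
  below that use \<open>THE\<close> are meaningful only where the object described exists and is unique.\<close>

definition Argmin :: "('a \<Rightarrow> 'b::order) \<Rightarrow> 'a set" where
  "Argmin h = {x. is_arg_min h (\<lambda>_. True) x}"

text \<open>The convex-analysis indicator function, not the 0/1-valued \<open>indicator\<close> of the library.\<close>

definition indicator_fun :: "'a set \<Rightarrow> 'a \<Rightarrow> ereal" where
  "indicator_fun C x = (if x \<in> C then 0 else \<infinity>)"

definition prox :: "('a::real_inner \<Rightarrow> ereal) \<Rightarrow> 'a \<Rightarrow> 'a" where
  "prox h x = (THE p. p \<in> Argmin (\<lambda>z. h z + ereal (1/2 * (norm (z - x))\<^sup>2)))"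

definition gradient :: "('a::real_inner \<Rightarrow> real) \<Rightarrow> 'a \<Rightarrow> 'a" where
  "gradient f x = (THE D. GDERIV f x :> D)"

definition prox_grad ::
    "real \<Rightarrow> ('a::real_inner \<Rightarrow> real) \<Rightarrow> ('a \<Rightarrow> ereal) \<Rightarrow> 'a \<Rightarrow> 'a" where
  "prox_grad \<beta> f g = prox (\<lambda>z. ereal (1/\<beta>) * g z) \<circ> (\<lambda>x. x - (1/\<beta>) *\<^sub>R gradient f x)"

text \<open>The library's \<open>closest_point\<close> requires \<open>heine_borel\<close>, which excludes infinite dimensions.\<close>

definition metric_proj :: "'a::metric_space set \<Rightarrow> 'a \<Rightarrow> 'a" where
  "metric_proj C x = (THE p. p \<in> C \<and> (\<forall>c\<in>C. dist x p \<le> dist x c))"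

definition fista_params :: "(nat \<Rightarrow> real) \<Rightarrow> bool" where
  "fista_params t \<longleftrightarrow>
     t 0 = 1 \<and>
     (\<forall>n. t n \<ge> (real n + 2) / 2 \<and> (t n)\<^sup>2 \<ge> (t (Suc n))\<^sup>2 - t (Suc n))"

definition fista_seqs ::
    "('a::real_vector \<Rightarrow> 'a) \<Rightarrow> (nat \<Rightarrow> real) \<Rightarrow> 'a \<Rightarrow> (nat \<Rightarrow> 'a) \<Rightarrow> (nat \<Rightarrow> 'a) \<Rightarrow> bool" where
  "fista_seqs T t x0 x y \<longleftrightarrow>
     x 0 = x0 \<and> y 0 = x0 \<and>
     (\<forall>n. x (Suc n) = T (y n) \<and>
          y (Suc n) = x (Suc n) + ((t n - 1) / t (Suc n)) *\<^sub>R (x (Suc n) - x n))"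

end

theory Submission
  imports Defs
begin

text \<open>
  Subtracting the fixed point \<open>s = P\<^sub>S x\<^sub>0\<close> turns the scheme into the linear recursion for
  \<open>b = 0\<close>, started at \<open>u = x\<^sub>0 - s\<close>, which is orthogonal to the kernel of \<open>A\<close>. The Beck--Teboulle
  energy bounds both the extrapolated points and \<open>t\<^sub>n \<parallel>A x\<^sub>n\<^sub>+\<^sub>1\<parallel>\<close>; since \<open>x\<^sub>n\<^sub>+\<^sub>1\<close> is a convex combination of
  \<open>x\<^sub>n\<close> and an extrapolated point, also \<open>\<parallel>x\<^sub>n\<parallel> \<le> \<parallel>u\<parallel>\<close>. Thus the linear maps \<open>u \<mapsto> x\<^sub>n\<close> are uniformly
  bounded, and it suffices to prove \<open>x\<^sub>n \<rightarrow> 0\<close> for \<open>u\<close> in the range of \<open>B = A\<^sup>*A\<close>, which is dense in the orthogonal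
  complement of the kernel. As the maps commute with \<open>B\<close>, for \<open>u = B v\<close> the iterates
  are \<open>A\<^sup>*\<close> applied to the residuals \<open>A x'\<^sub>n\<close> of the run started at \<open>v\<close>, and these tend to \<open>0\<close>.
\<close>

subsection \<open>Projections and adjoints in Hilbert spaces\<close>


text \<open>Near-minimizers of the distance form nested closed sets \<open>K n\<close> whose
  diameters shrink by the parallelogram law; completeness yields a common point.\<close>

lemma closest_point_exists_Hilbert:
  fixes C :: "'a::{real_inner, complete_space} set"
  assumes "closed C" "convex C" "C \<noteq> {}"
  obtains p where "p \<in> C" "\<And>c. c \<in> C \<Longrightarrow> dist x p \<le> dist x c"
proof -
  define \<delta> where "\<delta> = infdist x C"
  have \<delta>_le: "\<delta> \<le> norm (x - c)" if "c \<in> C" for c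
    using infdist_le[OF that, of x] by (simp add: \<delta>_def dist_norm)
  have \<delta>_nonneg: "0 \<le> \<delta>" by (simp add: \<delta>_def infdist_nonneg)
  define K where "K n = C \<inter> {c. (norm (x - c))\<^sup>2 \<le> \<delta>\<^sup>2 + inverse (real (Suc n))}" for n
  obtain p where p: "\<And>n. p \<in> K n"
  proof (rule decreasing_closed_nest[of K])
    show "closed (K n)" for n
      unfolding K_def by (intro closed_Int assms closed_Collect_le continuous_intros)
    show "K n \<subseteq> K m" if "m \<le> n" for m n
    proof -
      have "\<delta>\<^sup>2 + inverse (real (Suc n)) \<le> \<delta>\<^sup>2 + inverse (real (Suc m))" using that by simp
      then show ?thesis unfolding K_def by (blast intro: order_trans)
    qed
    show "K n \<noteq> {}" for n
    proof -
      have "\<delta> < sqrt (\<delta>\<^sup>2 + inverse (real (Suc n)))"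
        by (rule real_less_rsqrt) simp
      then obtain c where c: "c \<in> C" "dist x c < sqrt (\<delta>\<^sup>2 + inverse (real (Suc n)))"
        using cINF_less_iff[OF assms(3) bdd_below_image_dist, of x]
        unfolding \<delta>_def infdist_notempty[OF assms(3)] by blast
      then have "(norm (x - c))\<^sup>2 \<le> (sqrt (\<delta>\<^sup>2 + inverse (real (Suc n))))\<^sup>2"
        by (intro power_mono) (simp_all add: dist_norm)
      then have "c \<in> K n" using c by (simp add: K_def)
      then show ?thesis by blast
    qed
    show "\<exists>n. \<forall>u\<in>K n. \<forall>v\<in>K n. dist u v < e" if "e > 0" for e :: real
    proof -
      \<comment> \<open>The parallelogram identity below bounds
        \<open>(norm (u - v))\<^sup>2\<close> by four times the slack in \<open>K n\<close>, hence
        \<open>e\<^sup>2 / 4\<close>.\<close>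
      obtain n where n: "inverse (real (Suc n)) < e\<^sup>2 / 4"
        using reals_Archimedean[of "e\<^sup>2 / 4"] \<open>e > 0\<close> by (meson divide_pos_pos zero_less_numeral zero_less_power)
      have "dist u v < e" if "u \<in> K n" "v \<in> K n" for u v
      proof -
        let ?m = "(1/2) *\<^sub>R u + (1/2) *\<^sub>R v"
        have "?m \<in> C"
          using that convexD[OF assms(2), of u v "1/2" "1/2"] by (simp add: K_def)
        then have "\<delta>\<^sup>2 \<le> (norm (x - ?m))\<^sup>2"
          using \<delta>_le \<delta>_nonneg by (intro power_mono) auto
        moreover have "(norm (u - v))\<^sup>2
            = 2 * (norm (x - u))\<^sup>2 + 2 * (norm (x - v))\<^sup>2 - 4 * (norm (x - ?m))\<^sup>2"
          by (simp add: power2_norm_eq_inner inner_commute algebra_simps)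
        ultimately have "(norm (u - v))\<^sup>2 < e\<^sup>2"
          using that n by (simp add: K_def)
        then show ?thesis
          using \<open>e > 0\<close> by (simp add: dist_norm power_less_imp_less_base)
      qed
      then show ?thesis by blast
    qed
  qed blast
  have "(norm (x - p))\<^sup>2 \<le> \<delta>\<^sup>2"
  proof (rule field_le_epsilon)
    fix e :: real assume "e > 0"
    then obtain n where "inverse (real (Suc n)) < e" using reals_Archimedean by blast
    with p[of n] show "(norm (x - p))\<^sup>2 \<le> \<delta>\<^sup>2 + e" by (simp add: K_def)
  qed
  then have "norm (x - p) \<le> \<delta>"
    using \<delta>_nonneg by (rule power2_le_imp_le)
  moreover have "p \<in> C" using p[of 0] by (simp add: K_def)
  ultimately show thesis
    using \<delta>_le by (intro that[of p]) (auto simp: dist_norm intro: order_trans)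
qed

text \<open>Minimality along the single line through \<open>p\<close> in direction \<open>k\<close>
  is assumed, so that the lemma serves both subspace projections and the normal equations
  below.\<close>

lemma closest_point_orthogonal:
  fixes p :: "'a::real_inner"
  assumes min: "\<And>r. norm (x - p) \<le> norm (x - (p + r *\<^sub>R k))"
  shows "(x - p) \<bullet> k = 0"
proof (cases "k = 0")
  case False
  then have kk: "k \<bullet> k > 0" by simp
  \<comment> \<open>This \<open>r\<close> minimizes the quadratic expanded below; moving there would
    lower it by \<open>((x - p) \<bullet> k)\<^sup>2 / (k \<bullet> k)\<close>.\<close>
  define r where "r = ((x - p) \<bullet> k) / (k \<bullet> k)"
  have rk: "r * (k \<bullet> k) = (x - p) \<bullet> k" using kk by (simp add: r_def)
  have "(norm (x - p))\<^sup>2 \<le> (norm ((x - p) - r *\<^sub>R k))\<^sup>2"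
    using min[of r] by (intro power_mono) (simp_all add: diff_diff_eq)
  also have "\<dots> = (norm (x - p))\<^sup>2 - 2 * r * ((x - p) \<bullet> k) + r * (r * (k \<bullet> k))"
    by (simp only: power2_norm_eq_inner) (simp add: inner_diff inner_commute algebra_simps)
  also have "\<dots> = (norm (x - p))\<^sup>2 - r * ((x - p) \<bullet> k)" by (simp add: rk)
  finally have "((x - p) \<bullet> k)\<^sup>2 \<le> 0"
    using kk by (simp add: r_def power2_eq_square divide_le_0_iff)
  then show ?thesis by simp
qed simp

lemma orthogonal_decomposition_Hilbert:
  fixes M :: "'a::{real_inner, complete_space} set"
  assumes "closed M" "subspace M"
  obtains p where "p \<in> M" "\<And>k. k \<in> M \<Longrightarrow> (x - p) \<bullet> k = 0"
proof -
  obtain p where p: "p \<in> M" "\<And>c. c \<in> M \<Longrightarrow> dist x p \<le> dist x c"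
    using closest_point_exists_Hilbert[of M x] assms subspace_imp_convex subspace_0 by blast
  have "(x - p) \<bullet> k = 0" if "k \<in> M" for k
    using p that assms(2)
    by (intro closest_point_orthogonal) (auto simp: dist_norm subspace_add subspace_scale)
  with p(1) show thesis by (rule that)
qed

text \<open>Projecting \<open>x - s0\<close> onto \<open>M\<close> and shifting back gives a point
  whose Pythagorean identity shows minimality and uniqueness at once, which resolves the
  \<open>THE\<close>. The orthogonality is what the homogeneous recursion asks of its starting
  point.\<close>

lemma metric_proj_translated_subspace:
  fixes M :: "'a::{real_inner, complete_space} set"
  assumes "closed M" "subspace M" and S: "S = (+) s0 ` M"
  shows "metric_proj S x \<in> S" "k \<in> M \<Longrightarrow> (x - metric_proj S x) \<bullet> k = 0"
proof -
  obtain p where p: "p \<in> M" "\<And>k. k \<in> M \<Longrightarrow> ((x - s0) - p) \<bullet> k = 0"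
    using orthogonal_decomposition_Hilbert[OF assms(1,2)] by blast
  let ?p = "s0 + p"
  have orth: "(x - ?p) \<bullet> k = 0" if "k \<in> M" for k
    using p(2)[OF that] by (simp add: diff_diff_eq)
  have pyth: "(dist x c)\<^sup>2 = (dist x ?p)\<^sup>2 + (dist ?p c)\<^sup>2" if c: "c \<in> S" for c
  proof -
    obtain m where m: "m \<in> M" "c = s0 + m" using c unfolding S by blast
    then have "p - m \<in> M" using p(1) assms(2) by (simp add: subspace_diff)
    then have "(x - ?p) \<bullet> (?p - c) = 0" using orth m by simp
    moreover have "x - c = (x - ?p) + (?p - c)" by simp
    ultimately show ?thesis
      unfolding dist_norm by (metis norm_add_Pythagorean orthogonal_def)
  qed
  have "metric_proj S x = ?p"
    unfolding metric_proj_def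
  proof (rule the_equality)
    show "?p \<in> S \<and> (\<forall>c\<in>S. dist x ?p \<le> dist x c)"
    proof (intro conjI ballI)
      show "?p \<in> S" using p(1) S by blast
      show "dist x ?p \<le> dist x c" if "c \<in> S" for c
        by (rule power2_le_imp_le) (simp_all add: pyth[OF that])
    qed
    fix q assume q: "q \<in> S \<and> (\<forall>c\<in>S. dist x q \<le> dist x c)"
    then have "dist x q \<le> dist x ?p" using p(1) S by auto
    then have "(dist x q)\<^sup>2 \<le> (dist x ?p)\<^sup>2" by (intro power_mono) auto
    then show "q = ?p" using pyth[of q] q by simp
  qed
  then show "metric_proj S x \<in> S" "k \<in> M \<Longrightarrow> (x - metric_proj S x) \<bullet> k = 0"
    using p(1) S orth by auto
qed

section \<open>Riesz representation and the adjoint of a bounded operator\<close>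

lemma Riesz_representation:
  fixes \<phi> :: "'a::{real_inner, complete_space} \<Rightarrow> real"
  assumes "bounded_linear \<phi>"
  obtains w where "\<And>x. \<phi> x = x \<bullet> w"
proof (cases "\<forall>x. \<phi> x = 0")
  case True
  then show thesis by (intro that[of 0]) simp
next
  case False
  interpret bounded_linear \<phi> by fact
  obtain u where u: "\<phi> u \<noteq> 0" using False by blast
  have "closed {x. \<phi> x = 0}" by (intro closed_Collect_eq continuous_on continuous_intros)
  moreover have "subspace {x. \<phi> x = 0}" by (simp add: subspace_def add zero scaleR)
  ultimately obtain p where p: "\<phi> p = 0" "\<And>k. \<phi> k = 0 \<Longrightarrow> (u - p) \<bullet> k = 0"
    by (rule orthogonal_decomposition_Hilbert[of _ u]) blast
  define e where "e = u - p"
  have e: "\<phi> e = \<phi> u" by (simp add: e_def diff p(1))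
  then have "e \<noteq> 0" using u zero by auto
  then have ee: "e \<bullet> e \<noteq> 0" by simp
  have "\<phi> x = x \<bullet> ((\<phi> u / (e \<bullet> e)) *\<^sub>R e)" for x
  proof -
    \<comment> \<open>Since \<open>\<phi> e = \<phi> u\<close>, the second factor lies in the
      kernel, to which \<open>e\<close> is orthogonal.\<close>
    have "e \<bullet> (x - (\<phi> x / \<phi> u) *\<^sub>R e) = 0"
      unfolding e_def by (rule p(2)) (use u e in \<open>simp add: diff scaleR e_def\<close>)
    then have "x \<bullet> e = (\<phi> x / \<phi> u) * (e \<bullet> e)"
      by (simp add: inner_diff_right inner_commute)
    then show ?thesis using u ee by simp
  qed
  then show thesis by (rule that)
qed

text \<open>\<open>adjoint\<close> picks some map with this identity, so existence comes first:
  Riesz represents \<open>x \<mapsto> A x \<bullet> y\<close>.\<close>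

lemma adjoint_works_Hilbert:
  fixes A :: "'a::{real_inner, complete_space} \<Rightarrow> 'b::real_inner"
  assumes "bounded_linear A"
  shows "x \<bullet> adjoint A y = A x \<bullet> y"
proof -
  have "\<exists>w. \<forall>x. A x \<bullet> y = x \<bullet> w" for y
  proof -
    have "bounded_linear (\<lambda>x. A x \<bullet> y)"
      using bounded_linear_compose[OF bounded_linear_inner_left assms] by simp
    then show ?thesis using Riesz_representation by metis
  qed
  then obtain A' where "\<forall>x y. A x \<bullet> y = x \<bullet> A' y" by metis
  moreover from this have "adjoint A = A'" by (rule adjoint_unique)
  ultimately show ?thesis by simp
qed

lemma bounded_linear_adjoint_Hilbert:
  fixes A :: "'a::{real_inner, complete_space} \<Rightarrow> 'b::real_inner"
  assumes "bounded_linear A"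
  shows "bounded_linear (adjoint A)"
proof -
  note adj = adjoint_works_Hilbert[OF assms]
  obtain K where K: "K > 0" "\<And>x. norm (A x) \<le> norm x * K"
    using bounded_linear.pos_bounded[OF assms] by blast
  show ?thesis
  proof (rule bounded_linear_intro)
    show "adjoint A (x + y) = adjoint A x + adjoint A y" for x y
      by (rule iffD1[OF vector_eq_ldot]) (simp add: adj inner_add_right)
    show "adjoint A (r *\<^sub>R x) = r *\<^sub>R adjoint A x" for r x
      by (rule iffD1[OF vector_eq_ldot]) (simp add: adj)
    show "norm (adjoint A y) \<le> norm y * K" for y
    proof (cases "adjoint A y = 0")
      case False
      \<comment> \<open>The adjoint identity is tested at \<open>adjoint A y\<close> itself; one
        factor cancels at the end, so the zero case is separate.\<close>
      have "norm (adjoint A y) * norm (adjoint A y) = A (adjoint A y) \<bullet> y"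
        by (metis adj power2_eq_square power2_norm_eq_inner)
      also have "\<dots> \<le> norm (A (adjoint A y)) * norm y" by (rule norm_cauchy_schwarz)
      also have "\<dots> \<le> (norm (adjoint A y) * K) * norm y" using K by (intro mult_right_mono) auto
      finally show ?thesis using False by (simp add: mult.commute)
    qed (use K in simp)
  qed
qed

subsection \<open>The accelerated scheme for a homogeneous least-squares problem\<close>


lemma fista_params_bounds:
  assumes "fista_params t"
  shows "t n \<ge> 1" "t n \<ge> (real n + 2) / 2" "t n \<le> real n + 1"
    "(t (Suc n))\<^sup>2 - t (Suc n) \<le> (t n)\<^sup>2"
proof -
  show step: "(t (Suc n))\<^sup>2 - t (Suc n) \<le> (t n)\<^sup>2" and ge: "t n \<ge> (real n + 2) / 2" for n
    using assms by (auto simp: fista_params_def)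
  show ge1: "t n \<ge> 1" for n using ge[of n] by simp
  show "t n \<le> real n + 1"
  proof (induction n)
    case 0
    then show ?case using assms by (simp add: fista_params_def)
  next
    case (Suc n)
    \<comment> \<open>Otherwise \<open>t (Suc n) * (t (Suc n) - 1)\<close> would exceed
      \<open>(t n + 1) * t n\<close>, hence \<open>(t n)\<^sup>2\<close>, against the
      recursion.\<close>
    have "t (Suc n) \<le> t n + 1"
    proof (rule ccontr)
      assume "\<not> ?thesis"
      then have "(t n + 1) * t n < t (Suc n) * (t (Suc n) - 1)"
        using ge1[of n] by (intro mult_strict_mono) auto
      then show False using step[of n] ge1[of n] by (simp add: power2_eq_square algebra_simps)
    qed
    then show ?case using Suc by simp
  qed
qed

lemma fista_seqs_exist: "\<exists>x y. fista_seqs L t u x y"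
proof -
  define F where "F n p = (let x' = L (snd p) in
      (x', x' + ((t n - 1) / t (Suc n)) *\<^sub>R (x' - fst p)))" for n p
  define z where "z = rec_nat (u, u) F"
  have "fista_seqs L t u (fst \<circ> z) (snd \<circ> z)"
    by (simp add: fista_seqs_def z_def F_def Let_def)
  then show ?thesis by blast
qed

text \<open>Extrapolation is a linear combination, so a linear \<open>M\<close> intertwining the
  step maps transports runs. It is used with \<open>M = B\<close>, which commutes with the
  homogeneous step.\<close>

lemma fista_seqs_image:
  assumes "linear M" "\<And>v. M (L v) = L' (M v)" "fista_seqs L t u x y"
  shows "fista_seqs L' t (M u) (M \<circ> x) (M \<circ> y)"
  using assms(3) unfolding fista_seqs_def
  by (auto simp: assms(2) linear_add[OF assms(1)] linear_diff[OF assms(1)] linear_scale[OF assms(1)])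

text \<open>The difference may follow a third operator: for an affine \<open>L = L'\<close> it is
  the linear part, which is how the fixed point gets subtracted.\<close>

lemma fista_seqs_diff:
  assumes "\<And>v v'. L'' (v - v') = L v - L' v'" "fista_seqs L t u x y" "fista_seqs L' t u' x' y'"
  shows "fista_seqs L'' t (u - u') (\<lambda>n. x n - x' n) (\<lambda>n. y n - y' n)"
proof -
  have "(p + c *\<^sub>R (p - q)) - (p' + c *\<^sub>R (p' - q')) = (p - p') + c *\<^sub>R ((p - p') - (q - q'))"
    for p q p' q' :: 'a and c
    by (simp add: algebra_simps)
  then show ?thesis
    using assms unfolding fista_seqs_def by simp
qed

lemma fista_seqs_const: "L s = s \<Longrightarrow> fista_seqs L t s (\<lambda>_. s) (\<lambda>_. s)"
  by (simp add: fista_seqs_def)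

text \<open>The proximal-gradient inequality for
  \<open>v \<mapsto> (norm (A v))\<^sup>2 / 2\<close>, doubled: smoothness pays for the step from
  \<open>y\<close> to \<open>x'\<close>, convexity for the comparison with \<open>u\<close>.
  \<open>B\<close> plays the role of \<open>A\<^sup>*A\<close> through \<open>adj\<close>.\<close>

lemma gradient_step_descent:
  fixes A :: "'a::real_inner \<Rightarrow> 'b::real_inner" and y u :: 'a
  assumes "linear A" and adj: "\<And>v w. B v \<bullet> w = A v \<bullet> A w"
    and smooth: "\<And>v. (norm (A v))\<^sup>2 \<le> \<beta> * (norm v)\<^sup>2" and "\<beta> > 0"
  defines "x' \<equiv> y - (1/\<beta>) *\<^sub>R B y"
  shows "(norm (A x'))\<^sup>2 + \<beta> * (norm (x' - u))\<^sup>2 \<le> (norm (A u))\<^sup>2 + \<beta> * (norm (y - u))\<^sup>2"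
proof -
  define d where "d = x' - y"
  have x': "x' = y + d" by (simp add: d_def)
  \<comment> \<open>As \<open>\<beta> *\<^sub>R d = - B y\<close>, inner products with
    \<open>d\<close> move to the image space of \<open>A\<close>.\<close>
  have dw: "\<beta> * (d \<bullet> w) = - (A y \<bullet> A w)" for w
    using \<open>\<beta> > 0\<close> by (simp add: d_def x'_def adj)
  have "(norm (A x'))\<^sup>2 = (norm (A y))\<^sup>2 + 2 * (A y \<bullet> A d) + (norm (A d))\<^sup>2"
    by (simp add: x' linear_add[OF \<open>linear A\<close>] power2_norm_eq_inner inner_commute algebra_simps)
  moreover have "(norm (A d))\<^sup>2 \<le> - (A y \<bullet> A d)"
    using smooth[of d] dw[of d] by (simp add: power2_norm_eq_inner)
  moreover have "\<beta> * (norm (x' - u))\<^sup>2 - \<beta> * (norm (y - u))\<^sup>2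
      = \<beta> * (d \<bullet> d) + 2 * (\<beta> * (d \<bullet> (y - u)))"
    by (simp add: x' power2_norm_eq_inner inner_commute algebra_simps)
  moreover have "\<dots> = - (A y \<bullet> A d) - 2 * (norm (A y))\<^sup>2 + 2 * (A y \<bullet> A u)"
    unfolding dw by (simp add: linear_diff[OF \<open>linear A\<close>] power2_norm_eq_inner algebra_simps)
  moreover have "0 \<le> (norm (A y))\<^sup>2 - 2 * (A y \<bullet> A u) + (norm (A u))\<^sup>2"
    using zero_le_power2[of "norm (A y - A u)"]
    by (simp only: power2_norm_eq_inner) (simp add: inner_commute algebra_simps)
  ultimately show ?thesis by linarith
qed

text \<open>The left side is the Beck--Teboulle energy for the minimizer 0 and minimal value 0; it
  is nonincreasing in \<open>n\<close>.\<close>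

lemma fista_energy:
  fixes A :: "'a::real_inner \<Rightarrow> 'b::real_inner"
  assumes "linear A" and adj: "\<And>v w. B v \<bullet> w = A v \<bullet> A w"
    and smooth: "\<And>v. (norm (A v))\<^sup>2 \<le> \<beta> * (norm v)\<^sup>2" and "\<beta> > 0"
    and t: "fista_params t" and seqs: "fista_seqs (\<lambda>v. v - (1/\<beta>) *\<^sub>R B v) t u x y"
  shows "(t n)\<^sup>2 * (norm (A (x (Suc n))))\<^sup>2
    + \<beta> * (norm (t n *\<^sub>R x (Suc n) - (t n - 1) *\<^sub>R x n))\<^sup>2 \<le> \<beta> * (norm u)\<^sup>2"
proof -
  note tb = fista_params_bounds[OF t]
  have x0: "x 0 = u" and y0: "y 0 = u" and xS: "x (Suc n) = y n - (1/\<beta>) *\<^sub>R B (y n)"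
    and yS: "y (Suc n) = x (Suc n) + ((t n - 1) / t (Suc n)) *\<^sub>R (x (Suc n) - x n)" for n
    using seqs by (auto simp: fista_seqs_def)
  have step: "(t n)\<^sup>2 * (norm (A (x (Suc n))))\<^sup>2
      + \<beta> * (norm (t n *\<^sub>R x (Suc n) - (t n - 1) *\<^sub>R x n))\<^sup>2
      \<le> ((t n)\<^sup>2 - t n) * (norm (A (x n)))\<^sup>2 + \<beta> * (norm (t n *\<^sub>R y n - (t n - 1) *\<^sub>R x n))\<^sup>2" for n
  proof -
    have t1: "t n \<ge> 1" by (rule tb)
    \<comment> \<open>the descent inequality at the convex combination of \<open>x n\<close> and the minimizer \<open>0\<close>\<close>
    define w where "w = ((t n - 1) / t n) *\<^sub>R x n"
    have tw: "t n *\<^sub>R w = (t n - 1) *\<^sub>R x n" using t1 by (simp add: w_def)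
    have scale: "(norm (t n *\<^sub>R v - (t n - 1) *\<^sub>R x n))\<^sup>2 = (t n)\<^sup>2 * (norm (v - w))\<^sup>2" for v
      unfolding tw[symmetric] scaleR_diff_right[symmetric] by (simp add: power_mult_distrib)
    have "(t n)\<^sup>2 * (norm (A w))\<^sup>2 = (norm (A (t n *\<^sub>R w)))\<^sup>2"
      by (simp add: linear_scale[OF \<open>linear A\<close>] power_mult_distrib)
    also have "\<dots> = (t n - 1)\<^sup>2 * (norm (A (x n)))\<^sup>2"
      unfolding tw by (simp add: linear_scale[OF \<open>linear A\<close>] power_mult_distrib)
    \<comment> \<open>Convexity in disguise:
      \<open>(t n)\<^sup>2 - t n = (t n - 1)\<^sup>2 + (t n - 1)\<close>, and the last summand is
      nonnegative.\<close>
    also have "\<dots> \<le> ((t n)\<^sup>2 - t n) * (norm (A (x n)))\<^sup>2"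
      using t1 by (intro mult_right_mono) (auto simp: power2_eq_square algebra_simps)
    finally have Aw: "(t n)\<^sup>2 * (norm (A w))\<^sup>2 \<le> ((t n)\<^sup>2 - t n) * (norm (A (x n)))\<^sup>2" .
    have "(norm (A (x (Suc n))))\<^sup>2 + \<beta> * (norm (x (Suc n) - w))\<^sup>2
        \<le> (norm (A w))\<^sup>2 + \<beta> * (norm (y n - w))\<^sup>2"
      unfolding xS by (rule gradient_step_descent[OF assms(1-4)])
    then have "(t n)\<^sup>2 * ((norm (A (x (Suc n))))\<^sup>2 + \<beta> * (norm (x (Suc n) - w))\<^sup>2)
        \<le> (t n)\<^sup>2 * ((norm (A w))\<^sup>2 + \<beta> * (norm (y n - w))\<^sup>2)"
      by (intro mult_left_mono) auto
    then show ?thesis using Aw unfolding scale by (simp add: algebra_simps)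
  qed
  show ?thesis
  proof (induction n)
    case 0
    \<comment> \<open>The term in \<open>A (x 0)\<close> then has coefficient 0, and only
      \<open>\<beta> * (norm (y 0))\<^sup>2\<close> remains.\<close>
    have "t 0 = 1" using t by (simp add: fista_params_def)
    then show ?case using step[of 0] by (simp add: y0)
  next
    case (Suc n)
    \<comment> \<open>The extrapolation coefficient is tuned for this identity, which makes the
      distance terms telescope; the parameter inequality does the same for the residual
      terms.\<close>
    have "t (Suc n) *\<^sub>R y (Suc n) - (t (Suc n) - 1) *\<^sub>R x (Suc n)
        = t n *\<^sub>R x (Suc n) - (t n - 1) *\<^sub>R x n"
    proof -
      have "t (Suc n) *\<^sub>R y (Suc n) = t (Suc n) *\<^sub>R x (Suc n) + (t n - 1) *\<^sub>R (x (Suc n) - x n)"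
        using tb(1)[of "Suc n"] by (simp only: yS scaleR_add_right) simp
      then show ?thesis by (simp add: algebra_simps)
    qed
    moreover have "((t (Suc n))\<^sup>2 - t (Suc n)) * (norm (A (x (Suc n))))\<^sup>2
        \<le> (t n)\<^sup>2 * (norm (A (x (Suc n))))\<^sup>2"
      using tb(4)[of n] by (intro mult_right_mono) auto
    ultimately show ?case using step[of "Suc n"] Suc by simp
  qed
qed

lemma fista_iterates_bounded:
  fixes A :: "'a::real_inner \<Rightarrow> 'b::real_inner"
  assumes "linear A" and adj: "\<And>v w. B v \<bullet> w = A v \<bullet> A w"
    and smooth: "\<And>v. (norm (A v))\<^sup>2 \<le> \<beta> * (norm v)\<^sup>2" and "\<beta> > 0"
    and t: "fista_params t" and seqs: "fista_seqs (\<lambda>v. v - (1/\<beta>) *\<^sub>R B v) t u x y"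
  shows "norm (x n) \<le> norm u"
proof (induction n)
  case 0
  then show ?case using seqs by (simp add: fista_seqs_def)
next
  case (Suc n)
  have t1: "t n \<ge> 1" by (rule fista_params_bounds[OF t])
  let ?v = "t n *\<^sub>R x (Suc n) - (t n - 1) *\<^sub>R x n"
  have "\<beta> * (norm ?v)\<^sup>2 \<le> (t n)\<^sup>2 * (norm (A (x (Suc n))))\<^sup>2 + \<beta> * (norm ?v)\<^sup>2" by simp
  also have "\<dots> \<le> \<beta> * (norm u)\<^sup>2" by (rule fista_energy[OF assms])
  finally have v: "norm ?v \<le> norm u"
    using \<open>\<beta> > 0\<close> by simp
  \<comment> \<open>\<open>x (Suc n)\<close> averages \<open>?v\<close> and \<open>x n\<close> with
    weights \<open>1 / t n\<close> and \<open>1 - 1 / t n\<close>, nonnegative because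
    \<open>t n \<ge> 1\<close>.\<close>
  have "t n * norm (x (Suc n)) = norm (?v + (t n - 1) *\<^sub>R x n)" using t1 by simp
  also have "\<dots> \<le> norm ?v + norm ((t n - 1) *\<^sub>R x n)" by (rule norm_triangle_ineq)
  also have "\<dots> \<le> norm u + (t n - 1) * norm u"
    using v Suc t1 by (auto intro!: add_mono mult_left_mono)
  also have "\<dots> = t n * norm u" by (simp add: algebra_simps)
  finally show ?case using t1 by simp
qed

lemma fista_residual_tendsto_0:
  fixes A :: "'a::real_inner \<Rightarrow> 'b::real_inner"
  assumes "linear A" and adj: "\<And>v w. B v \<bullet> w = A v \<bullet> A w"
    and smooth: "\<And>v. (norm (A v))\<^sup>2 \<le> \<beta> * (norm v)\<^sup>2" and "\<beta> > 0"
    and t: "fista_params t" and seqs: "fista_seqs (\<lambda>v. v - (1/\<beta>) *\<^sub>R B v) t u x y"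
  shows "(\<lambda>n. A (x n)) \<longlonglongrightarrow> 0"
proof -
  define c where "c = sqrt \<beta> * norm u"
  have bound: "norm (A (x (Suc n))) \<le> 2 * c * inverse (real (Suc n))" for n
  proof -
    \<comment> \<open>Part of the bound \<open>(real n + 2) / 2\<close> is given away to match
      \<open>real (Suc n)\<close>.\<close>
    have tn: "t n > 0" "t n \<ge> real (Suc n) / 2" using fista_params_bounds(2)[OF t, of n] by auto
    have "(t n * norm (A (x (Suc n))))\<^sup>2 \<le> (t n)\<^sup>2 * (norm (A (x (Suc n))))\<^sup>2
        + \<beta> * (norm (t n *\<^sub>R x (Suc n) - (t n - 1) *\<^sub>R x n))\<^sup>2"
      using \<open>\<beta> > 0\<close> by (simp add: power_mult_distrib)
    also have "\<dots> \<le> \<beta> * (norm u)\<^sup>2" by (rule fista_energy[OF assms])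
    also have "\<dots> = c\<^sup>2" using \<open>\<beta> > 0\<close> by (simp add: c_def power_mult_distrib)
    finally have "t n * norm (A (x (Suc n))) \<le> c"
      by (rule power2_le_imp_le) (use \<open>\<beta> > 0\<close> in \<open>simp add: c_def\<close>)
    moreover have "real (Suc n) / 2 * norm (A (x (Suc n))) \<le> t n * norm (A (x (Suc n)))"
      using tn by (intro mult_right_mono) auto
    ultimately have "norm (A (x (Suc n))) * real (Suc n) \<le> 2 * c" by (simp add: mult.commute)
    then show ?thesis by (simp add: field_simps)
  qed
  have "(\<lambda>n. 2 * c * inverse (real (Suc n))) \<longlonglongrightarrow> 2 * c * 0"
    by (intro tendsto_intros LIMSEQ_inverse_real_of_nat)
  then have "(\<lambda>n. 2 * c * inverse (real (Suc n))) \<longlonglongrightarrow> 0" by simp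
  then have "(\<lambda>n. A (x (Suc n))) \<longlonglongrightarrow> 0"
    by (rule Lim_null_comparison[rotated]) (simp only: bound eventually_sequentiallyI)
  then show ?thesis by (rule LIMSEQ_imp_Suc)
qed

subsection \<open>Strong convergence\<close>


lemma subspace_closure:
  fixes M :: "'a::real_normed_vector set"
  assumes "subspace M"
  shows "subspace (closure M)"
  unfolding subspace_def
proof (intro conjI ballI allI)
  show "0 \<in> closure M"
    using subspace_0[OF assms] closure_subset by blast
  show "x + y \<in> closure M" if xy: "x \<in> closure M" "y \<in> closure M" for x y
  proof -
    obtain a b where "\<forall>n. a n \<in> M" "a \<longlonglongrightarrow> x" "\<forall>n. b n \<in> M" "b \<longlonglongrightarrow> y"
      using xy unfolding closure_sequential by blast
    then have "\<forall>n. a n + b n \<in> M" "(\<lambda>n. a n + b n) \<longlonglongrightarrow> x + y"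
      by (auto intro: subspace_add[OF assms] tendsto_add)
    then show ?thesis unfolding closure_sequential by fast
  qed
  show "c *\<^sub>R x \<in> closure M" if x: "x \<in> closure M" for c x
  proof -
    obtain a where "\<forall>n. a n \<in> M" "a \<longlonglongrightarrow> x"
      using x unfolding closure_sequential by blast
    then have "\<forall>n. c *\<^sub>R a n \<in> M" "(\<lambda>n. c *\<^sub>R a n) \<longlonglongrightarrow> c *\<^sub>R x"
      by (auto intro: subspace_scale[OF assms] tendsto_scaleR)
    then show ?thesis unfolding closure_sequential by fast
  qed
qed

text \<open>By symmetry, the component of \<open>u\<close> orthogonal to the closed range lies in
  the kernel. Both \<open>u\<close> and its projection are orthogonal to that component, so it
  vanishes.\<close>

lemma orthogonal_kernel_in_closure_range:
  fixes B :: "'a::{real_inner, complete_space} \<Rightarrow> 'a"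
  assumes "linear B" and sym: "\<And>v w. B v \<bullet> w = v \<bullet> B w"
    and u: "\<And>k. B k = 0 \<Longrightarrow> u \<bullet> k = 0"
  shows "u \<in> closure (range B)"
proof -
  have "subspace (closure (range B))"
    by (intro subspace_closure linear_subspace_image assms(1) subspace_UNIV)
  then obtain p where p: "p \<in> closure (range B)"
    and orth: "\<And>k. k \<in> closure (range B) \<Longrightarrow> (u - p) \<bullet> k = 0"
    using orthogonal_decomposition_Hilbert[OF closed_closure] by blast
  have "(u - p) \<bullet> B v = 0" for v
    using orth closure_subset by blast
  \<comment> \<open>For this choice of \<open>v\<close>, symmetry turns the left side into the
    squared norm of \<open>B (u - p)\<close>.\<close>
  from this[of "B (u - p)"] have "B (u - p) = 0" by (metis sym inner_eq_zero_iff)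
  then have "u \<bullet> (u - p) = 0" by (rule u)
  moreover have "p \<bullet> (u - p) = 0" using orth[OF p] by (simp add: inner_commute)
  ultimately have "(u - p) \<bullet> (u - p) = 0" by (simp add: inner_diff_left)
  then show ?thesis using p by simp
qed

lemma homogeneous_fista_tendsto_0:
  fixes A :: "'a::{real_inner, complete_space} \<Rightarrow> 'b::real_inner"
  assumes A: "bounded_linear A"
    and smooth: "\<And>v. (norm (A v))\<^sup>2 \<le> \<beta> * (norm v)\<^sup>2" and "\<beta> > 0"
    and t: "fista_params t"
    and seqs: "fista_seqs (\<lambda>v. v - (1/\<beta>) *\<^sub>R adjoint A (A v)) t u x y"
    and u: "\<And>k. A k = 0 \<Longrightarrow> u \<bullet> k = 0"
  shows "x \<longlonglongrightarrow> 0"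
proof -
  define B where "B v = adjoint A (A v)" for v
  define L where "L v = v - (1/\<beta>) *\<^sub>R B v" for v
  have seqs: "fista_seqs L t u x y" using seqs by (simp add: L_def[abs_def] B_def)
  have linA: "linear A" by (rule bounded_linear.linear[OF A])
  have linB: "linear B"
    using bounded_linear.linear[OF bounded_linear_compose[OF bounded_linear_adjoint_Hilbert[OF A] A]]
    by (simp add: B_def[abs_def])
  have adj: "B v \<bullet> w = A v \<bullet> A w" for v w
    by (metis B_def adjoint_works_Hilbert[OF A] inner_commute)
  have "A k = 0" if "B k = 0" for k
    using adj[of k k] that by simp
  then have dense: "u \<in> closure (range B)"
    by (intro orthogonal_kernel_in_closure_range linB u) (metis adj inner_commute, blast)
  note bounded = fista_iterates_bounded[OF linA adj smooth \<open>\<beta> > 0\<close> t,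
      folded L_def[abs_def]]
  note residual = fista_residual_tendsto_0[OF linA adj smooth \<open>\<beta> > 0\<close> t,
      folded L_def[abs_def]]
  show ?thesis
  proof (rule tendstoI)
    fix e :: real assume "e > 0"
    then obtain v where v: "norm (u - B v) < e / 2"
      using dense unfolding closure_approachable
      by (metis dist_commute dist_norm half_gt_zero imageE)
    obtain x' y' where seqs': "fista_seqs L t v x' y'"
      using fista_seqs_exist by blast
    have "B (L w) = L (B w)" for w
      by (simp add: L_def linear_diff[OF linB] linear_scale[OF linB])
    then have "fista_seqs L t (B v) (B \<circ> x') (B \<circ> y')"
      using fista_seqs_image[OF linB _ seqs'] by blast
    moreover have "L (w - w') = L w - L w'" for w w'
      by (simp add: L_def linear_diff[OF linB] algebra_simps)
    ultimately have
      "fista_seqs L t (u - B v) (\<lambda>n. x n - (B \<circ> x') n) (\<lambda>n. y n - (B \<circ> y') n)"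
      by (intro fista_seqs_diff[OF _ seqs])
    \<comment> \<open>The run from \<open>u - B v\<close> stays below \<open>e / 2\<close> at every
      index at once; this uniformity is what the iterate bound is for.\<close>
    from bounded[OF this] have near: "norm (x n - B (x' n)) < e / 2" for n
      unfolding comp_apply using v by (rule le_less_trans)
    \<comment> \<open>\<open>B (x' n)\<close> is \<open>adjoint A\<close> applied to the residual of
      the run from \<open>v\<close>, which vanishes in the limit whatever \<open>v\<close>
      is.\<close>
    have "(\<lambda>n. adjoint A (A (x' n))) \<longlonglongrightarrow> adjoint A 0"
      by (intro bounded_linear.tendsto[OF bounded_linear_adjoint_Hilbert[OF A]] residual[OF seqs'])
    then have "(\<lambda>n. B (x' n)) \<longlonglongrightarrow> 0"
      using linear_0[OF bounded_linear.linear[OF bounded_linear_adjoint_Hilbert[OF A]]]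
      by (simp add: B_def)
    then have "\<forall>\<^sub>F n in sequentially. dist (B (x' n)) 0 < e / 2"
      using \<open>e > 0\<close> by (intro tendstoD) auto
    then show "\<forall>\<^sub>F n in sequentially. dist (x n) 0 < e"
    proof eventually_elim
      case (elim n)
      have "norm (x n) \<le> norm (x n - B (x' n)) + norm (B (x' n))"
        by (metis diff_add_cancel norm_triangle_ineq)
      then show ?case using near[of n] elim by simp
    qed
  qed
qed

text \<open>The extrapolation coefficients are bounded, by the linear growth of \<open>t\<close>
  from both sides, and the increments of a convergent sequence vanish.\<close>

lemma fista_seqs_tendsto_both:
  fixes x y :: "nat \<Rightarrow> 'a::real_normed_vector"
  assumes t: "fista_params t" and seqs: "fista_seqs L t u x y" and x: "x \<longlonglongrightarrow> l"
  shows "y \<longlonglongrightarrow> l"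
proof -
  have xS: "(\<lambda>n. x (Suc n)) \<longlonglongrightarrow> l" using x by (rule LIMSEQ_Suc)
  have coeff: "norm ((t n - 1) / t (Suc n)) \<le> 2" for n
  proof -
    note b = fista_params_bounds[OF t]
    have "t n - 1 \<le> 2 * t (Suc n)" using b(3)[of n] b(2)[of "Suc n"] by simp
    then show ?thesis using b(1)[of n] b(1)[of "Suc n"] by (simp add: divide_le_eq)
  qed
  have "(\<lambda>n. x (Suc n) - x n) \<longlonglongrightarrow> 0"
    using tendsto_diff[OF xS x] by simp
  moreover have "Bfun (\<lambda>n. (t n - 1) / t (Suc n)) sequentially"
    by (rule BfunI[where K = 2]) (use coeff in auto)
  ultimately have "(\<lambda>n. ((t n - 1) / t (Suc n)) *\<^sub>R (x (Suc n) - x n)) \<longlonglongrightarrow> 0"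
    unfolding tendsto_Zfun_iff diff_0_right
    by (rule bounded_bilinear.Bfun_prod_Zfun[OF bounded_bilinear_scaleR, rotated])
  then have "(\<lambda>n. x (Suc n) + ((t n - 1) / t (Suc n)) *\<^sub>R (x (Suc n) - x n)) \<longlonglongrightarrow> l + 0"
    by (intro tendsto_add xS)
  then have "(\<lambda>n. y (Suc n)) \<longlonglongrightarrow> l"
    using seqs by (simp add: fista_seqs_def)
  then show ?thesis by (rule LIMSEQ_imp_Suc)
qed

section \<open>Least squares: gradient, trivial proximal step, normal equations\<close>

lemma GDERIV_least_squares:
  fixes A :: "'a::{real_inner, complete_space} \<Rightarrow> 'b::real_inner"
  assumes A: "bounded_linear A"
  shows "GDERIV (\<lambda>x. 1/2 * (norm (A x - b))\<^sup>2) x :> adjoint A (A x - b)"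
proof -
  have "((\<lambda>x. 1/2 * ((A x - b) \<bullet> (A x - b))) has_derivative
      (\<lambda>h. 1/2 * ((A x - b) \<bullet> (A h - 0) + (A h - 0) \<bullet> (A x - b)))) (at x)"
    by (intro derivative_intros has_derivative_mult_right bounded_linear_imp_has_derivative A)
  then show ?thesis
    by (simp add: gderiv_def power2_norm_eq_inner adjoint_works_Hilbert[OF A] inner_commute)
qed

lemma gradient_eqI:
  assumes "GDERIV f x :> D"
  shows "gradient f x = D"
  unfolding gradient_def
proof (rule the_equality)
  show "GDERIV f x :> D" by (rule assms)
  fix D' assume "GDERIV f x :> D'"
  then have "(\<lambda>h. h \<bullet> D') = (\<lambda>h. h \<bullet> D)"
    using assms has_derivative_unique unfolding gderiv_def by blast
  then show "D' = D" by (metis vector_eq_ldot)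
qed

text \<open>Here \<open>g\<close> and its scaling vanish everywhere, so \<open>T\<close> reduces to
  the plain gradient step.\<close>

lemma prox_zero: "prox (\<lambda>_. 0) x = x"
  unfolding prox_def Argmin_def
proof (rule the_equality)
  show "x \<in> {p. is_arg_min (\<lambda>z. 0 + ereal (1/2 * (norm (z - x))\<^sup>2)) (\<lambda>_. True) p}"
    by (simp add: is_arg_min_linorder)
  fix p assume "p \<in> {p. is_arg_min (\<lambda>z. 0 + ereal (1/2 * (norm (z - x))\<^sup>2)) (\<lambda>_. True) p}"
  then have "ereal (1/2 * (norm (p - x))\<^sup>2) \<le> ereal (1/2 * (norm (x - x))\<^sup>2)"
    unfolding is_arg_min_linorder mem_Collect_eq by (metis add_0)
  then show "p = x" by simp
qed

text \<open>A minimizer makes \<open>A x\<close> closest to \<open>b\<close> in the range of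
  \<open>A\<close>: orthogonality of the residual gives one direction, Pythagoras the other.\<close>

lemma Argmin_least_squares:
  fixes A :: "'a::{real_inner, complete_space} \<Rightarrow> 'b::real_inner"
  assumes A: "bounded_linear A"
  shows "Argmin (\<lambda>x. 1/2 * (norm (A x - b))\<^sup>2) = {x. adjoint A (A x - b) = 0}"
proof (intro set_eqI iffI)
  let ?f = "\<lambda>x. 1/2 * (norm (A x - b))\<^sup>2"
  fix x
  show "x \<in> {x. adjoint A (A x - b) = 0}" if "x \<in> Argmin ?f"
  proof -
    have min: "?f x \<le> ?f z" for z
      using that by (simp add: Argmin_def is_arg_min_linorder)
    have "(b - A x) \<bullet> A k = 0" for k
    proof (rule closest_point_orthogonal)
      fix r
      have "(norm (A x - b))\<^sup>2 \<le> (norm (A (x + r *\<^sub>R k) - b))\<^sup>2"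
        using min[of "x + r *\<^sub>R k"] by simp
      then have "norm (A x - b) \<le> norm (A (x + r *\<^sub>R k) - b)"
        by (rule power2_le_imp_le) simp
      then show "norm (b - A x) \<le> norm (b - (A x + r *\<^sub>R A k))"
        by (simp add: bounded_linear.linear[OF A] linear_add linear_scale norm_minus_commute)
    qed
    then have "k \<bullet> adjoint A (A x - b) = 0" for k
      unfolding adjoint_works_Hilbert[OF A] by (metis inner_commute inner_minus_left minus_diff_eq neg_equal_0_iff_equal)
    then show ?thesis by (metis inner_eq_zero_iff mem_Collect_eq)
  qed
  show "x \<in> Argmin ?f" if "x \<in> {x. adjoint A (A x - b) = 0}"
  proof -
    have "?f x \<le> ?f z" for z
    proof -
      have "A (z - x) \<bullet> (A x - b) = 0"
        using that by (simp flip: adjoint_works_Hilbert[OF A])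
      then have "orthogonal (A x - b) (A z - A x)"
        by (simp add: orthogonal_def inner_commute bounded_linear.linear[OF A] linear_diff)
      then have "(norm ((A x - b) + (A z - A x)))\<^sup>2 = (norm (A x - b))\<^sup>2 + (norm (A z - A x))\<^sup>2"
        by (rule norm_add_Pythagorean)
      then show ?thesis by simp
    qed
    then show ?thesis by (simp add: Argmin_def is_arg_min_linorder)
  qed
qed

text \<open>Turns the operator-norm bound on \<open>\<beta>\<close> into the quadratic bound
  \<open>smooth\<close> behind the energy estimates.\<close>

lemma norm_sq_le_onorm_adjoint_comp:
  fixes A :: "'a::{real_inner, complete_space} \<Rightarrow> 'b::real_inner"
  assumes A: "bounded_linear A"
  shows "(norm (A v))\<^sup>2 \<le> onorm (adjoint A \<circ> A) * (norm v)\<^sup>2"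
proof -
  have "bounded_linear (adjoint A \<circ> A)"
    using bounded_linear_compose[OF bounded_linear_adjoint_Hilbert[OF A] A] by (simp add: comp_def)
  note bound = onorm[OF this, of v]
  have "(norm (A v))\<^sup>2 = v \<bullet> (adjoint A \<circ> A) v"
    by (simp add: adjoint_works_Hilbert[OF A] power2_norm_eq_inner)
  also have "\<dots> \<le> norm v * norm ((adjoint A \<circ> A) v)" by (rule norm_cauchy_schwarz)
  also have "\<dots> \<le> norm v * (onorm (adjoint A \<circ> A) * norm v)"
    using bound by (intro mult_left_mono) auto
  finally show ?thesis by (simp add: power2_eq_square mult_ac)
qed

theorem corollary4p4:
  fixes A :: "'a::{real_inner, complete_space} \<Rightarrow> 'b::{real_inner, complete_space}"
    and b :: 'b
    and \<beta> :: real
    and f :: "'a \<Rightarrow> real"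
    and g :: "'a \<Rightarrow> ereal"
    and S :: "'a set"
    and T :: "'a \<Rightarrow> 'a"
  assumes "bounded_linear A"
    and "A \<noteq> (\<lambda>x. 0)"
    and "\<beta> \<ge> onorm (adjoint A \<circ> A)"
    and "f = (\<lambda>x. 1/2 * (norm (A x - b))\<^sup>2)"
    and "g = indicator_fun UNIV"
    and "S = Argmin f"
    and "S \<noteq> {}"
    and "T = prox_grad \<beta> f g"
  shows "(\<forall>x. T x = x - (1/\<beta>) *\<^sub>R adjoint A (A x - b)) \<and>
         (\<forall>t x0 x y. fista_params t \<and> fista_seqs T t x0 x y \<longrightarrow>
            x \<longlonglongrightarrow> metric_proj S x0 \<and> y \<longlonglongrightarrow> metric_proj S x0)"
proof -
  note A = \<open>bounded_linear A\<close>
  have linA: "linear A" by (rule bounded_linear.linear[OF A])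
  have linA': "linear (adjoint A)"
    by (rule bounded_linear.linear[OF bounded_linear_adjoint_Hilbert[OF A]])
  have T: "T x = x - (1/\<beta>) *\<^sub>R adjoint A (A x - b)" for x
    unfolding assms(8) prox_grad_def assms(4) assms(5) comp_apply
      gradient_eqI[OF GDERIV_least_squares[OF A]]
    by (simp add: indicator_fun_def prox_zero)
  have smooth: "(norm (A v))\<^sup>2 \<le> \<beta> * (norm v)\<^sup>2" for v
    using norm_sq_le_onorm_adjoint_comp[OF A, of v] mult_right_mono[OF assms(3), of "(norm v)\<^sup>2"]
    by simp
  have "\<beta> > 0"
  proof -
    obtain v where "A v \<noteq> 0" using assms(2) by blast
    then have "0 < \<beta> * (norm v)\<^sup>2" using smooth[of v] by (smt (verit) zero_less_norm_iff zero_less_power)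
    then show ?thesis by (simp add: zero_less_mult_iff)
  qed
  have S: "S = {x. adjoint A (A x - b) = 0}"
    unfolding assms(6) assms(4) by (rule Argmin_least_squares[OF A])
  obtain s0 where s0: "s0 \<in> S" using \<open>S \<noteq> {}\<close> by blast
  define M where "M = {k. A k = 0}"
  have M: "closed M" "subspace M"
    unfolding M_def
    by (intro closed_Collect_eq linear_continuous_on A continuous_intros)
       (simp add: subspace_def linA linear_add linear_scale linear_0)
  have S_M: "S = (+) s0 ` M"
  proof -
    \<comment> \<open>Minimizers differ by kernel elements of \<open>adjoint A \<circ> A\<close>;
      these are killed by \<open>A\<close>, because
      \<open>k \<bullet> adjoint A (A k) = (norm (A k))\<^sup>2\<close>.\<close>
    have ker: "adjoint A (A k) = 0 \<longleftrightarrow> A k = 0" for k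
      using adjoint_works_Hilbert[OF A, of k "A k"] linear_0[OF linA'] by auto
    have "z \<in> S \<longleftrightarrow> A (z - s0) = 0" for z
    proof -
      have "adjoint A (A z - b) = adjoint A (A (z - s0)) + adjoint A (A s0 - b)"
        by (simp add: linear_diff[OF linA] flip: linear_add[OF linA'])
      then show ?thesis using s0 ker by (simp add: S)
    qed
    then show ?thesis by (force simp: M_def image_iff intro: exI[where x = "_ - s0"])
  qed
  have "x \<longlonglongrightarrow> metric_proj S x0 \<and> y \<longlonglongrightarrow> metric_proj S x0"
    if t: "fista_params t" and seqs: "fista_seqs T t x0 x y" for t x0 x y
  proof -
    define s where "s = metric_proj S x0"
    have s: "s \<in> S" and orth: "\<And>k. A k = 0 \<Longrightarrow> (x0 - s) \<bullet> k = 0"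
      using metric_proj_translated_subspace[OF M S_M] by (auto simp: s_def M_def)
    have "T s = s" using s by (simp add: T S)
    \<comment> \<open>\<open>T\<close> is affine, so differences see only its linear part, and the
      fixed point \<open>s\<close> is itself a constant run.\<close>
    moreover have "(v - v') - (1/\<beta>) *\<^sub>R adjoint A (A (v - v')) = T v - T v'" for v v'
      by (simp add: T linear_diff[OF linA] linear_diff[OF linA'] algebra_simps)
    ultimately have "fista_seqs (\<lambda>v. v - (1/\<beta>) *\<^sub>R adjoint A (A v)) t
        (x0 - s) (\<lambda>n. x n - s) (\<lambda>n. y n - s)"
      by (intro fista_seqs_diff[OF _ seqs fista_seqs_const])
    then have "(\<lambda>n. x n - s) \<longlonglongrightarrow> 0"
      by (rule homogeneous_fista_tendsto_0[OF A smooth \<open>\<beta> > 0\<close> t _ orth])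
    then have "x \<longlonglongrightarrow> s" by (rule LIM_zero_cancel)
    with fista_seqs_tendsto_both[OF t seqs this] show ?thesis by (simp add: s_def)
  qed
  with T show ?thesis by blast
qed

end
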